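(* Let $G$ be a bridgeless cubic graph. If $G$ contains a semi-Kotzig frame $H$ with at most one non-circuit component, then $G$ has a $6$-even-subgraph double cover.
   Context: Graphs are finite and may have parallel edges. A subgraph is \emph{even} if every vertex has even degree in it; a \emph{circuit} is a connected $2$-regular subgraph. A \emph{$k$-even-subgraph double cover} of $G$ is a family of $k$ even subgraphs of $G$ such that every edge of $G$ lies in exactly two members of the family. Semi-Kotzig graph: let $K$ be a cubic graph with a proper $3$-edge-coloring $c:E(K)\to\mathbb Z_3$ having the property $(\ast)$: for each $\mu\in\{1,2\}$, the edges colored $0$ or $\mu$ induce a Hamilton circuit of $K$. Let $F$ be the $2$-factor of $K$ induced by the edges colored $1$ or $2$. If for every even subgraph $S\subseteq F$, interchanging colors $1$ and $2$ on the edges of $S$ yields a $3$-edge-coloring that again has property $(\ast)$, then $c$ is a \emph{semi-Kotzig coloring} and $K$ (with such a coloring) is a \emph{semi-Kotzig graph}. For a subgraph $H$ of $G$, the \emph{suppressed graph} $\overline{H}$ is obtained from $H$ by suppressing all vertices of degree $2$. The contracted graph $G/H$ is obtained from $G$ by contracting each component of $H$ to a single vertex (edges of $E(G)\setminus E(H)$ are kept, possibly as loops or parallel edges). A spanning subgraph $H$ of a cubic graph $G$ is a \emph{frame} if $G/H$ is an even graph. A frame $H$ is a \emph{semi-Kotzig frame} if for each component $H_i$ of $H$ that is not a circuit, the suppressed graph $\overline{H_i}$ is a semi-Kotzig graph (i.e. $H_i$ is a subdivision of a semi-Kotzig graph). *)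

theory Defs
  imports Main "HOL-Library.Multiset"
begin

text \<open>
  Undirected multigraphs. Each edge is a named object whose ends form a multiset of two
  vertices, so parallel edges are distinct edges with equal ends, and a loop at \<open>v\<close> has ends
  \<open>{#v, v#}\<close> and contributes 2 to the degree of \<open>v\<close>. Loops are needed for contracted graphs;
  a bridgeless cubic graph cannot have any.
\<close>

record ('v, 'e) multigraph =
  verts :: "'v set"
  edges :: "'e set"
  ends :: "'e \<Rightarrow> 'v multiset"

definition finite_graph :: "('v, 'e) multigraph \<Rightarrow> bool" where
  "finite_graph G \<longleftrightarrow> finite (verts G) \<and> finite (edges G) \<and>
     (\<forall>e\<in>edges G. size (ends G e) = 2 \<and> set_mset (ends G e) \<subseteq> verts G)"

definition deg :: "('v, 'e) multigraph \<Rightarrow> 'v \<Rightarrow> nat" where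
  "deg G v = (\<Sum>e\<in>edges G. count (ends G e) v)"

definition regular :: "nat \<Rightarrow> ('v, 'e) multigraph \<Rightarrow> bool" where
  "regular k G \<longleftrightarrow> (\<forall>v\<in>verts G. deg G v = k)"

abbreviation cubic :: "('v, 'e) multigraph \<Rightarrow> bool" where
  "cubic \<equiv> regular 3"

definition even_graph :: "('v, 'e) multigraph \<Rightarrow> bool" where
  "even_graph G \<longleftrightarrow> (\<forall>v\<in>verts G. even (deg G v))"

definition subgraph :: "('v, 'e) multigraph \<Rightarrow> ('v, 'e) multigraph \<Rightarrow> bool" where
  "subgraph H G \<longleftrightarrow>
     finite_graph H \<and> verts H \<subseteq> verts G \<and> edges H \<subseteq> edges G \<and> ends H = ends G"

definition vertex_induced :: "('v, 'e) multigraph \<Rightarrow> 'v set \<Rightarrow> ('v, 'e) multigraph" where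
  "vertex_induced G X =
     \<lparr>verts = X, edges = {e\<in>edges G. set_mset (ends G e) \<subseteq> X}, ends = ends G\<rparr>"

definition edge_induced :: "('v, 'e) multigraph \<Rightarrow> 'e set \<Rightarrow> ('v, 'e) multigraph" where
  "edge_induced G A = \<lparr>verts = (\<Union>e\<in>A. set_mset (ends G e)), edges = A, ends = ends G\<rparr>"

definition delete_edge :: "('v, 'e) multigraph \<Rightarrow> 'e \<Rightarrow> ('v, 'e) multigraph" where
  "delete_edge G e = G\<lparr>edges := edges G - {e}\<rparr>"

definition adjacent :: "('v, 'e) multigraph \<Rightarrow> 'v \<Rightarrow> 'v \<Rightarrow> bool" where
  "adjacent G u v \<longleftrightarrow> (\<exists>e\<in>edges G. ends G e = {#u, v#})"

definition reachable_from :: "('v, 'e) multigraph \<Rightarrow> 'v \<Rightarrow> 'v set" where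
  "reachable_from G v = {u. (adjacent G)\<^sup>*\<^sup>* v u}"

definition connected_graph :: "('v, 'e) multigraph \<Rightarrow> bool" where
  "connected_graph G \<longleftrightarrow>
     verts G \<noteq> {} \<and> (\<forall>u\<in>verts G. \<forall>v\<in>verts G. v \<in> reachable_from G u)"

definition graph_components :: "('v, 'e) multigraph \<Rightarrow> ('v, 'e) multigraph set" where
  "graph_components G = (\<lambda>v. vertex_induced G (reachable_from G v)) ` verts G"

definition bridge :: "('v, 'e) multigraph \<Rightarrow> 'e \<Rightarrow> bool" where
  "bridge G e \<longleftrightarrow> e \<in> edges G \<and>
     (\<exists>u v. ends G e = {#u, v#} \<and> v \<notin> reachable_from (delete_edge G e) u)"

definition bridgeless :: "('v, 'e) multigraph \<Rightarrow> bool" where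
  "bridgeless G \<longleftrightarrow> (\<forall>e\<in>edges G. \<not> bridge G e)"

definition circuit :: "('v, 'e) multigraph \<Rightarrow> bool" where
  "circuit C \<longleftrightarrow> finite_graph C \<and> connected_graph C \<and> regular 2 C"

definition hamilton_circuit :: "('v, 'e) multigraph \<Rightarrow> ('v, 'e) multigraph \<Rightarrow> bool" where
  "hamilton_circuit K C \<longleftrightarrow> subgraph C K \<and> circuit C \<and> verts C = verts K"

definition even_subgraph_double_cover ::
  "nat \<Rightarrow> ('v, 'e) multigraph \<Rightarrow> (nat \<Rightarrow> ('v, 'e) multigraph) \<Rightarrow> bool" where
  "even_subgraph_double_cover k G C \<longleftrightarrow>
     (\<forall>i<k. subgraph (C i) G \<and> even_graph (C i)) \<and>
     (\<forall>e\<in>edges G. card {i. i < k \<and> e \<in> edges (C i)} = 2)"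

text \<open>The elements of \<open>\<int>\<^sub>3\<close> serve only as the names 0, 1, 2 of the three colors.\<close>

definition proper_3_edge_coloring :: "('v, 'e) multigraph \<Rightarrow> ('e \<Rightarrow> nat) \<Rightarrow> bool" where
  "proper_3_edge_coloring K c \<longleftrightarrow> c ` edges K \<subseteq> {0, 1, 2} \<and>
     (\<forall>e\<in>edges K. \<forall>f\<in>edges K.
        e \<noteq> f \<and> set_mset (ends K e) \<inter> set_mset (ends K f) \<noteq> {} \<longrightarrow> c e \<noteq> c f)"

definition color_subgraph ::
  "('v, 'e) multigraph \<Rightarrow> ('e \<Rightarrow> nat) \<Rightarrow> nat set \<Rightarrow> ('v, 'e) multigraph" where
  "color_subgraph K c M = edge_induced K {e\<in>edges K. c e \<in> M}"

definition hamilton_property :: "('v, 'e) multigraph \<Rightarrow> ('e \<Rightarrow> nat) \<Rightarrow> bool" where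
  "hamilton_property K c \<longleftrightarrow> (\<forall>\<mu>\<in>{1, 2}. hamilton_circuit K (color_subgraph K c {0, \<mu>}))"

definition swap_colors :: "('e \<Rightarrow> nat) \<Rightarrow> 'e set \<Rightarrow> 'e \<Rightarrow> nat" where
  "swap_colors c A e =
     (if e \<in> A \<and> c e = 1 then 2 else if e \<in> A \<and> c e = 2 then 1 else c e)"

definition semi_kotzig_coloring :: "('v, 'e) multigraph \<Rightarrow> ('e \<Rightarrow> nat) \<Rightarrow> bool" where
  "semi_kotzig_coloring K c \<longleftrightarrow> proper_3_edge_coloring K c \<and> hamilton_property K c \<and>
     (\<forall>S. subgraph S (color_subgraph K c {1, 2}) \<and> even_graph S \<longrightarrow>
        proper_3_edge_coloring K (swap_colors c (edges S)) \<and>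
        hamilton_property K (swap_colors c (edges S)))"

definition semi_kotzig_graph :: "('v, 'e) multigraph \<Rightarrow> bool" where
  "semi_kotzig_graph K \<longleftrightarrow> finite_graph K \<and> cubic K \<and> (\<exists>c. semi_kotzig_coloring K c)"

text \<open>
  Suppressing a vertex \<open>v\<close> of degree 2 incident with two distinct edges \<open>e\<close> and \<open>f\<close>:
  delete \<open>v\<close> and replace the two edges by a single edge, which keeps the name \<open>e\<close>,
  joining their other ends.
\<close>

inductive suppress_vertex :: "('v, 'e) multigraph \<Rightarrow> ('v, 'e) multigraph \<Rightarrow> bool" where
  "\<lbrakk>v \<in> verts G; deg G v = 2; e \<in> edges G; f \<in> edges G; e \<noteq> f;
    ends G e = {#v, x#}; ends G f = {#v, y#}\<rbrakk>
   \<Longrightarrow> suppress_vertex G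
        \<lparr>verts = verts G - {v}, edges = edges G - {f}, ends = (ends G)(e := {#x, y#})\<rparr>"

text \<open>
  The suppressed graph depends on the order of the suppressions and on the edge names kept
  only up to isomorphism, so it is given as a relation.
\<close>

definition suppressed_graph :: "('v, 'e) multigraph \<Rightarrow> ('v, 'e) multigraph \<Rightarrow> bool" where
  "suppressed_graph H K \<longleftrightarrow> suppress_vertex\<^sup>*\<^sup>* H K \<and> (\<forall>v\<in>verts K. deg K v \<noteq> 2)"

text \<open>
  The vertices of \<open>G/H\<close> are the vertex sets of the components of \<open>H\<close>, together with a
  singleton for each vertex of \<open>G\<close> outside \<open>H\<close>.
\<close>

definition contract :: "('v, 'e) multigraph \<Rightarrow> ('v, 'e) multigraph \<Rightarrow> ('v set, 'e) multigraph" where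
  "contract G H = \<lparr>verts = reachable_from H ` verts G, edges = edges G - edges H,
     ends = (\<lambda>e. image_mset (reachable_from H) (ends G e))\<rparr>"

definition frame :: "('v, 'e) multigraph \<Rightarrow> ('v, 'e) multigraph \<Rightarrow> bool" where
  "frame G H \<longleftrightarrow> subgraph H G \<and> verts H = verts G \<and> even_graph (contract G H)"

definition semi_kotzig_frame :: "('v, 'e) multigraph \<Rightarrow> ('v, 'e) multigraph \<Rightarrow> bool" where
  "semi_kotzig_frame G H \<longleftrightarrow> frame G H \<and>
     (\<forall>C\<in>graph_components H. \<not> circuit C \<longrightarrow>
        (\<exists>K. suppressed_graph C K \<and> semi_kotzig_graph K))"

end

theory Submission imports Defs begin

text \<open>
  Put \<open>M = E(G) - E(H)\<close>. Transfer the semi-Kotzig coloring of the suppressed non-circuit component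
  to that component \<open>H\<^sub>0\<close> itself, and color all edges of the circuit components of \<open>H\<close> with 1. Let
  \<open>F\<close> be the even subgraph of the edges colored 1 or 2. Contract the components of \<open>F\<close> and consider
  the edges of \<open>M\<close> with both ends on \<open>F\<close>. Deleting from these a suitable even subgraph \<open>B\<close> of the
  contracted graph leaves a forest, so colors 1 and 2 can be interchanged on some components of \<open>F\<close>
  such that every remaining edge has ends of the same color. By the semi-Kotzig property, the
  colors 0 and \<open>\<mu>\<close> still form a circuit in \<open>H\<^sub>0\<close> for \<open>\<mu> = 1, 2\<close>. Now \<open>M\<close> splits into \<open>B\<close>,
  attached to the colors 1, 2, and two sets attached to the colors 0, 1 and 0, 2 respectively, and
  evenness of \<open>G/H\<close> shows that each of the three sets has an even number of ends on every component
  of its two-colored even subgraph \<open>Z\<close>. Each set thus extends by some \<open>P \<subseteq> Z\<close>, and also by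
  \<open>Z - P\<close>, to an even subgraph. These six even subgraphs form the double cover.
\<close>

section \<open>Parities of edge ends in vertex sets\<close>

definition cut_ends :: "('e \<Rightarrow> 'v multiset) \<Rightarrow> 'v set \<Rightarrow> 'e \<Rightarrow> nat" where
  "cut_ends \<phi> X e = size {#v \<in># \<phi> e. v \<in> X#}"

text \<open>For \<open>X = {v}\<close> this is the degree of \<open>v\<close> in the edge set
  \<open>A\<close>; in general it is the degree sum over \<open>X\<close>. For edges with two ends
  its parity is that of the number of edges of \<open>A\<close> leaving \<open>X\<close>.\<close>

definition total_ends :: "('e \<Rightarrow> 'v multiset) \<Rightarrow> 'e set \<Rightarrow> 'v set \<Rightarrow> nat" where
  "total_ends \<phi> A X = (\<Sum>e\<in>A. cut_ends \<phi> X e)"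

text \<open>
  For edges with two ends this says that no edge of \<open>Z\<close> leaves \<open>X\<close>, i.e. \<open>X\<close> is a union of
  components of \<open>Z\<close>. Stated by parity, it is visibly stable under symmetric differences.
\<close>

definition closed_under :: "('e \<Rightarrow> 'v multiset) \<Rightarrow> 'e set \<Rightarrow> 'v set \<Rightarrow> bool" where
  "closed_under \<phi> Z X \<longleftrightarrow> (\<forall>e\<in>Z. even (cut_ends \<phi> X e))"

definition covered :: "('e \<Rightarrow> 'v multiset) \<Rightarrow> 'e set \<Rightarrow> 'v set" where
  "covered \<phi> Z = (\<Union>e\<in>Z. set_mset (\<phi> e))"

text \<open>Stands in for a circuit: connectivity says that no union of components splits the
  covered vertices. The empty edge set qualifies, so a frame consisting of circuits only fits the
  same construction.\<close>

definition even_connected :: "('e \<Rightarrow> 'v multiset) \<Rightarrow> 'e set \<Rightarrow> bool" where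
  "even_connected \<phi> Z \<longleftrightarrow> (\<forall>v. even (total_ends \<phi> Z {v})) \<and>
     (\<forall>X. closed_under \<phi> Z X \<longrightarrow> covered \<phi> Z \<subseteq> X \<or> covered \<phi> Z \<inter> X = {})"

text \<open>
  What remains of a semi-Kotzig coloring when the edges of the graph are subdivided and every
  segment inherits the color of its edge.
\<close>

definition swappable_coloring :: "('e \<Rightarrow> 'v multiset) \<Rightarrow> 'e set \<Rightarrow> ('e \<Rightarrow> nat) \<Rightarrow> bool" where
  "swappable_coloring \<phi> E c \<longleftrightarrow> c ` E \<subseteq> {0, 1, 2} \<and>
     (\<forall>S\<subseteq>{e\<in>E. c e \<in> {1, 2}}. (\<forall>v. even (total_ends \<phi> S {v})) \<longrightarrow>
        (\<forall>\<mu>\<in>{1, 2}. even_connected \<phi> {e\<in>E. swap_colors c S e \<in> {0, \<mu>}}))"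

lemma pair_of_size_2:
  assumes "size m = 2"
  obtains u w where "m = {#u, w#}"
proof -
  obtain u m' where "m = add_mset u m'" "size m' = 1"
    using assms size_eq_Suc_imp_eq_union[of m 1] by auto
  then show thesis using that size_1_singleton_mset by metis
qed

lemma cut_ends_singleton: "cut_ends \<phi> {v} e = count (\<phi> e) v"
proof -
  have "{#u \<in># m. u = v#} = replicate_mset (count m v) v" for m :: "'b multiset"
    by (rule filter_eq_replicate_mset)
  then show ?thesis by (simp add: cut_ends_def)
qed

lemma total_ends_singleton: "total_ends \<phi> A {v} = (\<Sum>e\<in>A. count (\<phi> e) v)"
  by (simp add: total_ends_def cut_ends_singleton)

lemma cut_ends_sym_diff:
  "even (cut_ends \<phi> (sym_diff X Y) e) \<longleftrightarrow> (even (cut_ends \<phi> X e) \<longleftrightarrow> even (cut_ends \<phi> Y e))"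
proof -
  have "even (size {#v \<in># m. v \<in> sym_diff X Y#}) \<longleftrightarrow>
      (even (size {#v \<in># m. v \<in> X#}) \<longleftrightarrow> even (size {#v \<in># m. v \<in> Y#}))" for m :: "'b multiset"
    by (induction m) auto
  then show ?thesis unfolding cut_ends_def .
qed

lemma cut_ends_Compl: "cut_ends \<phi> X e + cut_ends \<phi> (- X) e = size (\<phi> e)"
  by (simp add: cut_ends_def flip: size_union)

lemma cut_ends_cong:
  assumes "\<And>v. v \<in># \<phi> e \<Longrightarrow> v \<in> X \<longleftrightarrow> v \<in> Y"
  shows "cut_ends \<phi> X e = cut_ends \<phi> Y e"
  using assms by (auto simp: cut_ends_def intro: arg_cong[where f=size] filter_mset_cong)

lemma cut_ends_eq_0_iff: "cut_ends \<phi> X e = 0 \<longleftrightarrow> set_mset (\<phi> e) \<inter> X = {}"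
  by (auto simp: cut_ends_def filter_mset_eq_conv)

lemma even_cut_ends_iff:
  assumes "size (\<phi> e) = 2"
  shows "even (cut_ends \<phi> X e) \<longleftrightarrow> set_mset (\<phi> e) \<subseteq> X \<or> set_mset (\<phi> e) \<inter> X = {}"
proof -
  obtain u w where "\<phi> e = {#u, w#}" using pair_of_size_2[OF assms] .
  then show ?thesis by (auto simp: cut_ends_def)
qed

lemma total_ends_union:
  assumes "finite A" "finite B" "A \<inter> B = {}"
  shows "total_ends \<phi> (A \<union> B) X = total_ends \<phi> A X + total_ends \<phi> B X"
  using assms by (simp add: total_ends_def sum.union_disjoint)

lemma total_ends_insert:
  assumes "finite A" "e \<notin> A"
  shows "total_ends \<phi> (insert e A) X = cut_ends \<phi> X e + total_ends \<phi> A X"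
  using assms by (simp add: total_ends_def)

lemma total_ends_Diff:
  assumes "finite A" "B \<subseteq> A"
  shows "total_ends \<phi> A X = total_ends \<phi> (A - B) X + total_ends \<phi> B X"
  unfolding total_ends_def by (rule sum.subset_diff[OF assms(2,1)])

lemma total_ends_sym_diff:
  "even (total_ends \<phi> A (sym_diff X Y)) \<longleftrightarrow> (even (total_ends \<phi> A X) \<longleftrightarrow> even (total_ends \<phi> A Y))"
proof (induction A rule: infinite_finite_induct)
  case (insert e A)
  show ?case
    unfolding total_ends_insert[OF insert.hyps] even_add insert.IH cut_ends_sym_diff by argo
qed (auto simp: total_ends_def)

lemma closed_under_sym_diff:
  "closed_under \<phi> Z X \<Longrightarrow> closed_under \<phi> Z Y \<Longrightarrow> closed_under \<phi> Z (sym_diff X Y)"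
  unfolding closed_under_def cut_ends_sym_diff by simp

lemma closed_under_total_ends: "closed_under \<phi> Z X \<Longrightarrow> A \<subseteq> Z \<Longrightarrow> even (total_ends \<phi> A X)"
  unfolding closed_under_def total_ends_def by (auto intro!: dvd_sum)

section \<open>Joins and balanced signed graphs\<close>

text \<open>
  The \<open>T\<close>-join theorem, with \<open>T\<close> the set of vertices of odd degree in \<open>B\<close>.
\<close>

lemma join_exists:
  assumes "finite Z" "finite B" "Z \<inter> B = {}"
    and "\<And>X. closed_under \<phi> Z X \<Longrightarrow> even (total_ends \<phi> B X)"
  shows "\<exists>P\<subseteq>Z. \<forall>X. even (total_ends \<phi> (P \<union> B) X)"
  using assms
proof (induction Z arbitrary: B rule: finite_induct)
  case empty
  then show ?case by (simp add: closed_under_def)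
next
  case (insert e Z)
  show ?case
  proof (cases "\<forall>X. closed_under \<phi> Z X \<longrightarrow> even (total_ends \<phi> B X)")
    case True
    then have "\<exists>P\<subseteq>Z. \<forall>X. even (total_ends \<phi> (P \<union> B) X)" using insert.IH[of B] insert.prems by blast
    then show ?thesis by blast
  next
    case False
    \<comment> \<open>\<open>Y\<close> forces \<open>e\<close> into the join, so \<open>e\<close> is
      moved over to \<open>B\<close>. A set \<open>X\<close> closed under \<open>Z\<close> that
      \<open>e\<close> leaves becomes closed under \<open>insert e Z\<close> after taking the
      symmetric difference with \<open>Y\<close>, and both \<open>B\<close> and \<open>e\<close> are
      odd on \<open>Y\<close>.\<close>
    then obtain Y where Y: "closed_under \<phi> Z Y" "odd (total_ends \<phi> B Y)" by blast
    have e: "odd (cut_ends \<phi> Y e)" using Y insert.prems(3)[of Y] by (auto simp: closed_under_def)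
    have "even (total_ends \<phi> (insert e B) X)" if X: "closed_under \<phi> Z X" for X
    proof (cases "even (cut_ends \<phi> X e)")
      case True
      then have "even (total_ends \<phi> B X)" using X insert.prems(3)[of X] by (auto simp: closed_under_def)
      then show ?thesis using True insert.prems by (simp add: total_ends_insert)
    next
      case False
      then have "even (cut_ends \<phi> (sym_diff X Y) e)" using e cut_ends_sym_diff[of \<phi> X Y e] by blast
      then have "closed_under \<phi> (insert e Z) (sym_diff X Y)"
        using closed_under_sym_diff[OF X Y(1)] unfolding closed_under_def by blast
      then have "even (total_ends \<phi> B (sym_diff X Y))" by (rule insert.prems(3))
      then have "odd (total_ends \<phi> B X)" using Y(2) total_ends_sym_diff[of \<phi> B X Y] by blast
      then show ?thesis using False insert.prems by (simp add: total_ends_insert)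
    qed
    moreover have "finite (insert e B)" "Z \<inter> insert e B = {}" using insert.prems insert.hyps by auto
    ultimately obtain P where P: "P \<subseteq> Z" "\<And>X. even (total_ends \<phi> (P \<union> insert e B) X)"
      using insert.IH[of "insert e B"] by blast
    have "insert e P \<union> B = P \<union> insert e B" by blast
    then show ?thesis using P by (metis insert_mono)
  qed
qed

text \<open>
  In the multigraph obtained by contracting the components of \<open>F\<close>, the edges \<open>N\<close> signed by \<open>s\<close>
  become balanced after deleting a suitable even subgraph \<open>B\<close>; the set \<open>Y\<close> is the switching set.
\<close>

lemma balancing_switch:
  assumes "finite N" "finite F" "N \<inter> F = {}"
  shows "\<exists>B Y. B \<subseteq> N \<and> (\<forall>X. closed_under \<phi> F X \<longrightarrow> even (total_ends \<phi> B X)) \<and>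
    closed_under \<phi> F Y \<and> (\<forall>e\<in>N - B. odd (cut_ends \<phi> Y e) \<longleftrightarrow> s e)"
  using assms(1,3)
proof (induction N rule: finite_induct)
  case empty
  show ?case by (intro exI[of _ "{}"]) (simp add: closed_under_def total_ends_def cut_ends_def)
next
  case (insert e N)
  then obtain B Y where B: "B \<subseteq> N" "\<forall>X. closed_under \<phi> F X \<longrightarrow> even (total_ends \<phi> B X)"
    and Y: "closed_under \<phi> F Y" "\<forall>e\<in>N - B. odd (cut_ends \<phi> Y e) \<longleftrightarrow> s e"
    by auto
  have finN: "finite N" "finite B" using insert.hyps B(1) finite_subset by auto
  \<comment> \<open>The new edge has the right sign already, or its sign can be flipped by a set
    \<open>Y'\<close> that no edge of \<open>F\<close> or \<open>N - B\<close> leaves, or its ends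
    are joined through \<open>F \<union> (N - B)\<close>.\<close>
  consider "odd (cut_ends \<phi> Y e) \<longleftrightarrow> s e"
    | Y' where "\<not> (odd (cut_ends \<phi> Y e) \<longleftrightarrow> s e)" "closed_under \<phi> (F \<union> (N - B)) Y'" "odd (cut_ends \<phi> Y' e)"
    | "\<And>X. closed_under \<phi> (F \<union> (N - B)) X \<Longrightarrow> even (cut_ends \<phi> X e)"
    by blast
  then show ?case
  proof cases
    case 1
    then show ?thesis using B Y by (intro exI[of _ B] exI[of _ Y]) auto
  next
    case 2
    have "closed_under \<phi> F Y'" using 2(2) by (auto simp: closed_under_def)
    then have "closed_under \<phi> F (sym_diff Y Y')" using closed_under_sym_diff[OF Y(1)] by blast
    moreover have "odd (cut_ends \<phi> (sym_diff Y Y') g) \<longleftrightarrow> s g" if "g \<in> insert e N - B" for g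
    proof (cases "g = e")
      case True
      then show ?thesis using 2 cut_ends_sym_diff[of \<phi> Y Y' e] by blast
    next
      case False
      then have "even (cut_ends \<phi> Y' g)" "odd (cut_ends \<phi> Y g) \<longleftrightarrow> s g"
        using that 2(2) Y(2) by (auto simp: closed_under_def)
      then show ?thesis using cut_ends_sym_diff[of \<phi> Y Y' g] by blast
    qed
    ultimately show ?thesis using B(1,2)
      by (intro exI[of _ B] exI[of _ "sym_diff Y Y'"]) (simp add: subset_insertI2)
  next
    case 3
    \<comment> \<open>Here \<open>e\<close> closes an even subgraph \<open>P \<union> {e}\<close>.
      Its part outside \<open>F\<close> is moved to \<open>B\<close>; the part inside
      \<open>F\<close> has even count on every set closed under \<open>F\<close>. No edge outside
      the enlarged \<open>B\<close> is new, so \<open>Y\<close> still works.\<close>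
    have "\<exists>P\<subseteq>F \<union> (N - B). \<forall>X. even (total_ends \<phi> (P \<union> {e}) X)"
      using finN assms(2) insert.hyps insert.prems 3
      by (intro join_exists) (auto simp: total_ends_def)
    then obtain P where P: "P \<subseteq> F \<union> (N - B)" "\<And>X. even (total_ends \<phi> (P \<union> {e}) X)" by blast
    define B' where "B' = B \<union> (insert e (P - F))"
    have fin: "finite P" using P(1) finN assms(2) finite_subset by blast
    have "even (total_ends \<phi> B' X)" if X: "closed_under \<phi> F X" for X
    proof -
      have "P \<union> {e} = insert e (P - F) \<union> (P \<inter> F)" by auto
      then have "total_ends \<phi> (P \<union> {e}) X = total_ends \<phi> (insert e (P - F)) X + total_ends \<phi> (P \<inter> F) X"
        using fin insert.prems total_ends_union[of "insert e (P - F)" "P \<inter> F" \<phi> X] by auto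
      moreover have "even (total_ends \<phi> (P \<inter> F) X)" using closed_under_total_ends[OF X] by blast
      ultimately have "even (total_ends \<phi> (insert e (P - F)) X)" using P(2)[of X] by simp
      moreover have "total_ends \<phi> B' X = total_ends \<phi> B X + total_ends \<phi> (insert e (P - F)) X"
        unfolding B'_def using finN fin P(1) B(1) insert.hyps by (intro total_ends_union) auto
      ultimately show ?thesis using B(2) X by simp
    qed
    moreover have "B' \<subseteq> insert e N" "insert e N - B' \<subseteq> N - B"
      using B(1) P(1) by (auto simp: B'_def)
    ultimately show ?thesis using Y by (intro exI[of _ B'] exI[of _ Y]) blast
  qed
qed

section \<open>Semi-Kotzig colorings and their subdivisions\<close>

lemma swappable_coloringD:
  assumes "swappable_coloring \<phi> E c" "S \<subseteq> {e\<in>E. c e \<in> {1, 2}}" "\<And>v. even (total_ends \<phi> S {v})"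
    and "\<mu> \<in> {1, 2}"
  shows "even_connected \<phi> {e\<in>E. swap_colors c S e \<in> {0, \<mu>}}"
  using assms unfolding swappable_coloring_def by blast

lemma reachable_from_closed:
  assumes "closed_under (ends G) (edges G) X" "\<And>e. e \<in> edges G \<Longrightarrow> size (ends G e) = 2"
    and "u \<in> X" "w \<in> reachable_from G u"
  shows "w \<in> X"
proof -
  have "(adjacent G)\<^sup>*\<^sup>* u w" using assms(4) by (simp add: reachable_from_def)
  then show ?thesis
  proof (induction rule: rtranclp_induct)
    case (step y z)
    then obtain e where e: "e \<in> edges G" "ends G e = {#y, z#}" by (auto simp: adjacent_def)
    then have "even (cut_ends (ends G) X e)" using assms(1) by (simp add: closed_under_def)
    then show ?case using e step.IH by (auto simp: cut_ends_def split: if_splits)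
  qed (rule assms(3))
qed

text \<open>A closed set containing one vertex of the circuit contains everything reachable from it;
  degrees are 2 on the circuit and 0 elsewhere.\<close>

lemma circuit_even_connected:
  assumes "circuit (edge_induced K Z)"
  shows "even_connected (ends K) Z"
proof -
  let ?C = "edge_induced K Z"
  have C: "finite_graph ?C" "connected_graph ?C" "regular 2 ?C" using assms by (auto simp: circuit_def)
  have verts: "verts ?C = covered (ends K) Z" by (simp add: edge_induced_def covered_def)
  have "even (total_ends (ends K) Z {v})" for v
  proof (cases "v \<in> verts ?C")
    case True
    then have "deg ?C v = 2" using C(3) by (simp add: regular_def)
    then show ?thesis by (simp add: deg_def edge_induced_def total_ends_singleton)
  next
    case False
    then have "count (ends K e) v = 0" if "e \<in> Z" for e
      using that by (auto simp: verts covered_def count_eq_zero_iff)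
    then show ?thesis by (simp add: total_ends_singleton)
  qed
  moreover have "covered (ends K) Z \<subseteq> X" if X: "closed_under (ends K) Z X" and x: "x \<in> covered (ends K) Z \<inter> X" for X x
  proof
    fix y assume "y \<in> covered (ends K) Z"
    then have "y \<in> reachable_from ?C x" using C(2) x by (auto simp: connected_graph_def verts)
    then show "y \<in> X"
      using reachable_from_closed[of ?C X x y] X x C(1) by (auto simp: finite_graph_def edge_induced_def)
  qed
  ultimately show ?thesis unfolding even_connected_def by blast
qed

lemma semi_kotzig_coloring_swappable:
  assumes "finite_graph K" "semi_kotzig_coloring K c"
  shows "swappable_coloring (ends K) (edges K) c"
  unfolding swappable_coloring_def
proof (intro conjI allI impI ballI)
  show "c ` edges K \<subseteq> {0, 1, 2}"
    using assms(2) by (simp add: semi_kotzig_coloring_def proper_3_edge_coloring_def)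
next
  fix S \<mu>
  assume S: "S \<subseteq> {e \<in> edges K. c e \<in> {1, 2}}" "\<forall>v. even (total_ends (ends K) S {v})"
    and \<mu>: "\<mu> \<in> {1, 2 :: nat}"
  have "finite (edges K)" using assms(1) by (simp add: finite_graph_def)
  then have "finite S" using S(1) by (auto elim: finite_subset[rotated])
  then have "subgraph (edge_induced K S) (color_subgraph K c {1, 2})"
    using assms(1) S(1)
    by (auto simp: subgraph_def color_subgraph_def edge_induced_def finite_graph_def)
  moreover have "even_graph (edge_induced K S)"
    using S(2) by (simp add: even_graph_def deg_def edge_induced_def total_ends_singleton)
  moreover have "edges (edge_induced K S) = S" by (simp add: edge_induced_def)
  ultimately have "hamilton_property K (swap_colors c S)"
    using assms(2) unfolding semi_kotzig_coloring_def by metis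
  then have "circuit (color_subgraph K (swap_colors c S) {0, \<mu>})"
    using \<mu> unfolding hamilton_property_def hamilton_circuit_def by blast
  then show "even_connected (ends K) {e \<in> edges K. swap_colors c S e \<in> {0, \<mu>}}"
    unfolding color_subgraph_def by (rule circuit_even_connected)
qed

text \<open>Undoing a suppression gives \<open>f\<close> the color of \<open>e\<close>. As
  \<open>v\<close> has no other edges, an edge set even at \<open>v\<close> contains both
  \<open>e\<close> and \<open>f\<close> or neither, so even sets before and after correspond by
  dropping \<open>f\<close>. Positive degrees are carried along because every end of an edge outside
  the frame must later see an edge of the frame.\<close>

lemma suppress_vertex_swappable:
  assumes "suppress_vertex G G'" "\<exists>c. swappable_coloring (ends G') (edges G') c"
    and pos: "\<And>u. u \<in> verts G' \<Longrightarrow> deg G' u > 0"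
  shows "(\<exists>c. swappable_coloring (ends G) (edges G) c) \<and> (\<forall>u\<in>verts G. deg G u > 0)"
  using assms(1)
proof cases
  case (1 v e f x y)
  let ?\<phi> = "ends G" and ?\<psi> = "ends G'"
  have G': "verts G' = verts G - {v}" "edges G' = edges G - {f}" "?\<psi> = ?\<phi>(e := {#x, y#})"
    using 1 by auto
  have sum2: "(\<Sum>g\<in>edges G. count (?\<phi> g) v) = 2" using 1 by (simp add: deg_def)
  \<comment> \<open>A sum over an infinite set would be 0, not 2.\<close>
  then have fin: "finite (edges G)" by (metis sum.infinite zero_neq_numeral)
  have "(\<Sum>g\<in>edges G. count (?\<phi> g) v) =
      count (?\<phi> e) v + (count (?\<phi> f) v + (\<Sum>g\<in>edges G - {e} - {f}. count (?\<phi> g) v))"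
    using 1 fin by (simp add: sum.remove[of _ e] sum.remove[of _ f])
  \<comment> \<open>Both \<open>e\<close> and \<open>f\<close> contribute at least 1 to the degree 2
    of \<open>v\<close>, which rules out loops and further edges there.\<close>
  then have v: "x \<noteq> v" "y \<noteq> v" "(\<Sum>g\<in>edges G - {e} - {f}. count (?\<phi> g) v) = 0"
    using sum2 1 by auto
  then have other: "v \<notin># ?\<phi> g" if "g \<in> edges G" "g \<noteq> e" "g \<noteq> f" for g
    using that fin by (simp add: count_eq_zero_iff)
  have total: "total_ends ?\<phi> A {u} = total_ends ?\<psi> (A - {f}) {u}"
    if A: "A \<subseteq> edges G" "e \<in> A \<longleftrightarrow> f \<in> A" and u: "u \<noteq> v" for A u
  proof -
    have finA: "finite A" using A(1) fin finite_subset by blast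
    have eq: "(\<Sum>g\<in>A - {e} - {f}. count (?\<psi> g) u) = (\<Sum>g\<in>A - {e} - {f}. count (?\<phi> g) u)"
      by (intro sum.cong) (auto simp: G')
    show ?thesis
    proof (cases "e \<in> A")
      case True
      have "(\<Sum>g\<in>A. count (?\<phi> g) u) =
          count (?\<phi> e) u + (count (?\<phi> f) u + (\<Sum>g\<in>A - {e} - {f}. count (?\<phi> g) u))"
        using 1 finA True A by (simp add: sum.remove[of _ e] sum.remove[of _ f])
      moreover have "(\<Sum>g\<in>A - {f}. count (?\<psi> g) u) = count (?\<psi> e) u + (\<Sum>g\<in>A - {f} - {e}. count (?\<psi> g) u)"
        using finA True 1 by (intro sum.remove) auto
      moreover have "A - {f} - {e} = A - {e} - {f}" by blast
      ultimately show ?thesis using eq 1 u by (simp add: total_ends_singleton G')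
    next
      case False
      then have "A - {e} - {f} = A" "A - {f} = A" using A by auto
      then show ?thesis using eq by (simp add: total_ends_singleton)
    qed
  qed
  have at_v: "even (total_ends ?\<phi> A {v}) \<longleftrightarrow> (e \<in> A \<longleftrightarrow> f \<in> A)" if "A \<subseteq> edges G" for A
  proof -
    have "finite A" using that fin finite_subset by blast
    moreover have "count (?\<phi> g) v = (if g = e then 1 else 0) + (if g = f then 1 else 0)" if "g \<in> A" for g
      using that other[of g] \<open>A \<subseteq> edges G\<close> 1 v by (auto simp: count_eq_zero_iff)
    ultimately show ?thesis by (simp add: total_ends_singleton sum.distrib cong: sum.cong)
  qed
  \<comment> \<open>Evenness is demanded at every point of the type, hence also at \<open>v\<close>,
    which has left the graph.\<close>
  have v_trace: "total_ends ?\<psi> A {v} = 0" if "A \<subseteq> edges G - {f}" for A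
  proof -
    have "count (?\<psi> g) v = 0" if "g \<in> A" for g
      using that other[of g] \<open>A \<subseteq> edges G - {f}\<close> v by (auto simp: G' count_eq_zero_iff)
    then show ?thesis by (simp add: total_ends_singleton)
  qed
  \<comment> \<open>Edges \<open>e\<close> and \<open>f\<close> of \<open>Z\<close> place
    \<open>x\<close>, \<open>v\<close> and \<open>y\<close> on the same side of any closed set, so
    that set stays closed after suppression; the covered vertices differ at most by
    \<open>v\<close>.\<close>
  have lift: "even_connected ?\<phi> Z"
    if Z: "Z \<subseteq> edges G" "e \<in> Z \<longleftrightarrow> f \<in> Z" and con: "even_connected ?\<psi> (Z - {f})" for Z
  proof -
    have "even (total_ends ?\<phi> Z {u})" for u
      using total[OF Z, of u] at_v[OF Z(1)] Z con by (cases "u = v") (auto simp: even_connected_def)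
    moreover have "covered ?\<phi> Z \<subseteq> X \<or> covered ?\<phi> Z \<inter> X = {}" if X: "closed_under ?\<phi> Z X" for X
    proof -
      have vxy: "(x \<in> X \<longleftrightarrow> v \<in> X) \<and> (y \<in> X \<longleftrightarrow> v \<in> X)" if "e \<in> Z"
      proof -
        have "even (cut_ends ?\<phi> X e)" "even (cut_ends ?\<phi> X f)"
          using X that Z by (auto simp: closed_under_def)
        then show ?thesis using 1 by (auto simp: cut_ends_def split: if_splits)
      qed
      have "even (cut_ends ?\<psi> X g)" if "g \<in> Z - {f}" for g
      proof (cases "g = e")
        case True
        then show ?thesis using vxy that by (auto simp: cut_ends_def G')
      next
        case False
        then show ?thesis using X that by (auto simp: cut_ends_def G' closed_under_def)
      qed
      then have "covered ?\<psi> (Z - {f}) \<subseteq> X \<or> covered ?\<psi> (Z - {f}) \<inter> X = {}"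
        using con unfolding even_connected_def closed_under_def by blast
      moreover have "covered ?\<phi> Z = covered ?\<psi> (Z - {f}) \<union> {v}" "x \<in> covered ?\<psi> (Z - {f})" if "e \<in> Z"
      proof -
        have "Z = insert e (insert f (Z - {e} - {f}))" "Z - {f} = insert e (Z - {e} - {f})"
          using that Z 1 by auto
        then have "covered ?\<phi> Z = set_mset (?\<phi> e) \<union> set_mset (?\<phi> f) \<union> covered ?\<phi> (Z - {e} - {f})"
          "covered ?\<psi> (Z - {f}) = set_mset (?\<psi> e) \<union> covered ?\<psi> (Z - {e} - {f})"
          unfolding covered_def by (metis Union_image_insert Un_assoc)+
        moreover have "covered ?\<psi> (Z - {e} - {f}) = covered ?\<phi> (Z - {e} - {f})"
          by (auto simp: covered_def G')
        ultimately show "covered ?\<phi> Z = covered ?\<psi> (Z - {f}) \<union> {v}" "x \<in> covered ?\<psi> (Z - {f})"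
          using 1 by (auto simp: G')
      qed
      moreover have "covered ?\<phi> Z = covered ?\<psi> (Z - {f})" if "e \<notin> Z"
        using that Z by (auto simp: covered_def G' split: if_splits)
      ultimately show ?thesis using vxy by (cases "e \<in> Z") auto
    qed
    ultimately show ?thesis unfolding even_connected_def by blast
  qed
  obtain c where c: "swappable_coloring ?\<psi> (edges G - {f}) c" using assms(2) by (auto simp: G')
  define k where "k = c(f := c e)"
  have "even_connected ?\<phi> {g \<in> edges G. swap_colors k S g \<in> {0, \<mu>}}"
    if S: "S \<subseteq> {g \<in> edges G. k g \<in> {1, 2}}" "\<And>u. even (total_ends ?\<phi> S {u})" and \<mu>: "\<mu> \<in> {1, 2}" for S \<mu>
  proof (rule lift)
    have SE: "S \<subseteq> edges G" and ef: "e \<in> S \<longleftrightarrow> f \<in> S" using S at_v[of S] by auto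
    have sw: "swap_colors k S f = swap_colors k S e" using ef 1 by (simp add: swap_colors_def k_def)
    then show "e \<in> {g \<in> edges G. swap_colors k S g \<in> {0, \<mu>}} \<longleftrightarrow> f \<in> {g \<in> edges G. swap_colors k S g \<in> {0, \<mu>}}"
      using 1 by simp
    have "even (total_ends ?\<psi> (S - {f}) {u})" for u
      using total[OF SE ef, of u] S(2)[of u] v_trace[OF Diff_mono[OF SE order_refl]] by (cases "u = v") auto
    moreover have "S - {f} \<subseteq> {g \<in> edges G - {f}. c g \<in> {1, 2}}" using S(1) by (auto simp: k_def)
    ultimately have "even_connected ?\<psi> {g \<in> edges G - {f}. swap_colors c (S - {f}) g \<in> {0, \<mu>}}"
      using swappable_coloringD[OF c _ _ \<mu>] by blast
    moreover have "swap_colors k S g = swap_colors c (S - {f}) g" if "g \<noteq> f" for g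
      using that by (simp add: swap_colors_def k_def)
    then have "{g \<in> edges G. swap_colors k S g \<in> {0, \<mu>}} - {f} =
        {g \<in> edges G - {f}. swap_colors c (S - {f}) g \<in> {0, \<mu>}}"
      by (simp add: set_eq_iff) metis
    ultimately show "even_connected ?\<psi> ({g \<in> edges G. swap_colors k S g \<in> {0, \<mu>}} - {f})" by simp
  qed auto
  moreover have "k ` edges G \<subseteq> {0, 1, 2}"
  proof -
    have "c ` (edges G - {f}) \<subseteq> {0, 1, 2}" using c by (simp add: swappable_coloring_def)
    then show ?thesis using 1(4-6) by (auto simp: k_def)
  qed
  ultimately have "swappable_coloring ?\<phi> (edges G) k" by (simp add: swappable_coloring_def)
  moreover have "deg G u > 0" if "u \<in> verts G" for u
  proof (cases "u = v")
    case False
    then show ?thesis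
      using pos[of u] that total[of "edges G" u] 1 by (simp add: deg_def G' total_ends_singleton)
  qed (use 1 in simp)
  ultimately show ?thesis by blast
qed

lemma suppressed_semi_kotzig_swappable:
  assumes "suppressed_graph H K" "semi_kotzig_graph K"
  shows "(\<exists>c. swappable_coloring (ends H) (edges H) c) \<and> (\<forall>v\<in>verts H. deg H v > 0)"
proof -
  have "suppress_vertex\<^sup>*\<^sup>* H K" using assms(1) by (simp add: suppressed_graph_def)
  then show ?thesis
  proof (induction rule: converse_rtranclp_induct)
    case base
    then show ?case
      using assms(2) semi_kotzig_coloring_swappable by (auto simp: semi_kotzig_graph_def regular_def)
  next
    case (step G G')
    then show ?case using suppress_vertex_swappable by blast
  qed
qed

section \<open>Complementary joins and colors at a vertex\<close>

lemma total_ends_cong_at: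
  assumes "finite A" "finite B" "\<And>e. v \<in># \<phi> e \<Longrightarrow> e \<in> A \<longleftrightarrow> e \<in> B"
  shows "total_ends \<phi> A {v} = total_ends \<phi> B {v}"
proof -
  have incident: "total_ends \<phi> C {v} = (\<Sum>e\<in>{e\<in>C. v \<in># \<phi> e}. count (\<phi> e) v)" if "finite C" for C
    unfolding total_ends_singleton using that
    by (intro sum.mono_neutral_right) (auto simp: count_eq_zero_iff)
  have "{e\<in>A. v \<in># \<phi> e} = {e\<in>B. v \<in># \<phi> e}" using assms(3) by blast
  then show ?thesis by (simp add: incident assms(1,2))
qed

text \<open>All degrees in \<open>Z\<close> are even, so replacing a join \<open>P\<close> by
  \<open>Z - P\<close> keeps all parities. The resulting two subgraphs cover \<open>Z\<close> once
  and \<open>B\<close> twice.\<close>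

lemma complementary_joins:
  assumes "finite Z" "finite B" "Z \<inter> B = {}"
    and ev: "\<And>v. even (total_ends \<phi> Z {v})"
    and "\<And>X. closed_under \<phi> Z X \<Longrightarrow> even (total_ends \<phi> B X)"
  shows "\<exists>P\<subseteq>Z. \<forall>v. even (total_ends \<phi> (B \<union> P) {v}) \<and> even (total_ends \<phi> (B \<union> (Z - P)) {v})"
proof -
  obtain P where P: "P \<subseteq> Z" "\<And>X. even (total_ends \<phi> (P \<union> B) X)"
    using join_exists[OF assms(1-3,5)] by blast
  have finP: "finite P" using P(1) assms(1) finite_subset by blast
  have "even (total_ends \<phi> (B \<union> (Z - P)) {v})" for v
  proof -
    have "total_ends \<phi> (B \<union> (Z - P)) {v} = total_ends \<phi> B {v} + total_ends \<phi> (Z - P) {v}"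
      "total_ends \<phi> (P \<union> B) {v} = total_ends \<phi> P {v} + total_ends \<phi> B {v}"
      using assms(1-3) finP P(1) by (auto intro!: total_ends_union)
    then show ?thesis using total_ends_Diff[OF assms(1) P(1), of \<phi> "{v}"] ev[of v] P(2)[of "{v}"] by presburger
  qed
  moreover have "even (total_ends \<phi> (B \<union> P) {v})" for v
    using P(2)[of "{v}"] by (simp only: Un_commute[of B P])
  ultimately show ?thesis using P(1) by (intro exI[of _ P] conjI allI)
qed

lemma total_ends_color_classes:
  assumes "finite E" "a \<noteq> b"
  shows "total_ends \<phi> {e\<in>E. k e \<in> {a, b}} X = total_ends \<phi> {e\<in>E. k e = a} X + total_ends \<phi> {e\<in>E. k e = b} X"
proof -
  have "{e\<in>E. k e \<in> {a, b}} = {e\<in>E. k e = a} \<union> {e\<in>E. k e = b}" by auto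
  then show ?thesis using assms by (simp add: total_ends_union disjoint_iff)
qed

text \<open>Adding the counts for colors 0, 1 and for colors 0, 2 counts color 0 twice.\<close>

lemma even_colors_12:
  fixes k :: "'e \<Rightarrow> nat"
  assumes "finite E" "\<And>\<mu>. \<mu> \<in> {1, 2} \<Longrightarrow> even (total_ends \<phi> {e\<in>E. k e \<in> {0, \<mu>}} X)"
  shows "even (total_ends \<phi> {e\<in>E. k e \<in> {1, 2}} X)"
proof -
  have "even (total_ends \<phi> {e\<in>E. k e \<in> {0, 1}} X)" "even (total_ends \<phi> {e\<in>E. k e \<in> {0, 2}} X)"
    using assms(2) by blast+
  then show ?thesis
    using total_ends_color_classes[OF assms(1), of 0 1 \<phi> k X] total_ends_color_classes[OF assms(1), of 0 2 \<phi> k X]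
      total_ends_color_classes[OF assms(1), of 1 2 \<phi> k X] by simp
qed

text \<open>The three color degrees \<open>t 0\<close>, \<open>t 1\<close>, \<open>t 2\<close> have
  equal parity and sum at most 2. They cannot all be odd, so all are even and at most one is
  nonzero.\<close>

lemma monochromatic_vertex:
  fixes k :: "'e \<Rightarrow> nat"
  assumes "finite E" "k ` E \<subseteq> {0, 1, 2}"
    and "\<And>\<mu>. \<mu> \<in> {1, 2} \<Longrightarrow> even (total_ends \<phi> {e\<in>E. k e \<in> {0, \<mu>}} {v})"
    and "total_ends \<phi> E {v} \<le> 2"
    and "g \<in> E" "v \<in># \<phi> g" "h \<in> E" "v \<in># \<phi> h"
  shows "k g = k h"
proof -
  define t where "t a = total_ends \<phi> {e\<in>E. k e = a} {v}" for a
  have "total_ends \<phi> ({e\<in>E. k e \<in> {0, 1}} \<union> {e\<in>E. k e = 2}) {v} = total_ends \<phi> {e\<in>E. k e \<in> {0, 1}} {v} + t 2"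
    unfolding t_def using assms(1) by (intro total_ends_union) auto
  moreover have "{e\<in>E. k e \<in> {0, 1}} \<union> {e\<in>E. k e = 2} = E" using assms(2) by auto
  ultimately have "total_ends \<phi> E {v} = total_ends \<phi> {e\<in>E. k e \<in> {0, 1}} {v} + t 2" by simp
  then have sum: "t 0 + t 1 + t 2 \<le> 2"
    using assms(4) total_ends_color_classes[OF assms(1), of 0 1 \<phi> k "{v}"] by (simp add: t_def)
  have ev: "even (t 0 + t 1)" "even (t 0 + t 2)"
    using assms(3)[of 1] assms(3)[of 2] total_ends_color_classes[OF assms(1), of 0 1 \<phi> k "{v}"]
      total_ends_color_classes[OF assms(1), of 0 2 \<phi> k "{v}"] by (simp_all add: t_def)
  have pos: "t (k e) > 0" if "e \<in> E" "v \<in># \<phi> e" for e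
  proof -
    have "count (\<phi> e) v \<le> t (k e)"
      unfolding t_def total_ends_singleton using that assms(1) by (intro member_le_sum) auto
    then show ?thesis using that(2) by (metis count_greater_zero_iff less_le_trans)
  qed
  have "k g \<in> {0, 1, 2}" "k h \<in> {0, 1, 2}" using assms by blast+
  moreover have "t a = 0 \<or> t b = 0" if "a \<in> {0, 1, 2}" "b \<in> {0, 1, 2}" "a \<noteq> b" for a b
  proof -
    have "t 0 = 0 \<or> t 1 = 0" "t 0 = 0 \<or> t 2 = 0" "t 1 = 0 \<or> t 2 = 0"
      using sum ev by presburger+
    then show ?thesis using that by auto
  qed
  ultimately show ?thesis using pos[OF assms(5,6)] pos[OF assms(7,8)] by (metis less_numeral_extra(3))
qed


section \<open>Construction of the six even subgraphs\<close>

text \<open>The argument needs only edge sets: \<open>D\<close> and \<open>M\<close> are the edges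
  inside and outside the frame, and \<open>W\<close> is the vertex set of the non-circuit component,
  or empty. Vertices outside \<open>W\<close> lie on the circuits of the frame.\<close>

lemma six_cover_of_swappable_coloring:
  fixes \<phi> :: "'e \<Rightarrow> 'v multiset"
  assumes fin: "finite V" "finite D" "finite M" and disj: "D \<inter> M = {}"
    and size2: "\<And>e. e \<in> D \<union> M \<Longrightarrow> size (\<phi> e) = 2"
    and inV: "\<And>e. e \<in> D \<union> M \<Longrightarrow> set_mset (\<phi> e) \<subseteq> V"
    and deg3: "\<And>v. v \<in> V \<Longrightarrow> total_ends \<phi> (D \<union> M) {v} = 3"
    and W: "closed_under \<phi> D W"
    and c: "swappable_coloring \<phi> {e\<in>D. set_mset (\<phi> e) \<subseteq> W} c"
    and posW: "\<And>v. v \<in> V \<inter> W \<Longrightarrow> total_ends \<phi> D {v} > 0"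
    and circ: "\<And>v. v \<in> V - W \<Longrightarrow> total_ends \<phi> D {v} = 2"
    and frame: "\<And>X. X \<subseteq> V \<Longrightarrow> closed_under \<phi> D X \<Longrightarrow> even (total_ends \<phi> M X)"
  shows "\<exists>A. (\<forall>i<6::nat. A i \<subseteq> D \<union> M \<and> (\<forall>v. even (total_ends \<phi> (A i) {v}))) \<and>
    (\<forall>e\<in>D \<union> M. card {i. i < 6 \<and> e \<in> A i} = 2)"
proof -
  define E where "E = {e\<in>D. set_mset (\<phi> e) \<subseteq> W}"
  define k where "k e = (if e \<in> E then c e else 1)" for e
  define F where "F = {e\<in>D. k e \<in> {1, 2}}"
  \<comment> \<open>If \<open>Y\<close> is closed under \<open>F\<close>, an edge of
    \<open>F\<close> meeting \<open>Y\<close> lies inside it, so \<open>Y\<close> selects components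
    of \<open>F\<close> on which 1 and 2 are interchanged.\<close>
  define sw where "sw Y = swap_colors k {e\<in>F. cut_ends \<phi> Y e \<noteq> 0}" for Y
  define Q where "Q Y \<mu> = {e\<in>D. sw Y e \<in> {0, \<mu>}}" for Y \<mu>
  have finE: "finite E" and finF: "finite F" and finQ: "finite (Q Y \<mu>)" for Y \<mu>
    using fin by (auto simp: E_def F_def Q_def)
  have ED: "E \<subseteq> D" and FD: "F \<subseteq> D" and QD: "Q Y \<mu> \<subseteq> D" for Y \<mu>
    by (auto simp: E_def F_def Q_def)
  have outW: "set_mset (\<phi> e) \<inter> W = {}" if "e \<in> D" "e \<notin> E" for e
    using that W size2 even_cut_ends_iff[of \<phi> e W] by (auto simp: closed_under_def E_def)
  have EW: "e \<in> E \<longleftrightarrow> v \<in> W" if "e \<in> D" "v \<in># \<phi> e" for e v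
    using that outW[of e] by (auto simp: E_def)
  have cE: "c ` E \<subseteq> {0, 1, 2}" using c by (simp add: swappable_coloring_def E_def)
  have kD: "k ` D \<subseteq> {0, 1, 2}" using cE by (auto simp: k_def)
  have Fcut: "cut_ends \<phi> Y e \<noteq> 0 \<longleftrightarrow> v \<in> Y" if "closed_under \<phi> F Y" "e \<in> F" "v \<in># \<phi> e" for Y e v
    using that size2[of e] FD even_cut_ends_iff[of \<phi> e Y] cut_ends_eq_0_iff[of \<phi> Y e]
    by (auto simp: closed_under_def)
  \<comment> \<open>Any end of \<open>e\<close> decides whether its color changes;
    \<open>3 - k e\<close> interchanges 1 and 2.\<close>
  have sw: "sw Y e = (if k e = 0 then 0 else if v \<in> Y then 3 - k e else k e)"
    if "closed_under \<phi> F Y" "e \<in> D" "v \<in># \<phi> e" for Y e v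
  proof (cases "k e = 0")
    case True
    then show ?thesis by (simp add: sw_def swap_colors_def)
  next
    case False
    then have "k e = 1 \<or> k e = 2" using kD that(2) by auto
    moreover from this have "e \<in> F" using that(2) by (auto simp: F_def)
    ultimately show ?thesis using Fcut[OF that(1) _ that(3)] that(2) by (auto simp: sw_def swap_colors_def)
  qed
  have nonempty: "\<exists>v. v \<in># \<phi> e" if "e \<in> D \<union> M" for e
    using size2[OF that] by (metis multiset_nonemptyE size_empty zero_neq_numeral)
  \<comment> \<open>Interchanging along the empty set gives the color classes of \<open>c\<close>
    itself.\<close>
  have c0: "even (total_ends \<phi> {e\<in>E. c e \<in> {0, \<mu>}} {v})" if "\<mu> \<in> {1, 2}" for \<mu> v
  proof -
    have "even_connected \<phi> {e\<in>E. swap_colors c {} e \<in> {0, \<mu>}}"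
      using swappable_coloringD[OF c, of "{}"] that by (simp add: total_ends_def E_def)
    then show ?thesis by (simp add: even_connected_def swap_colors_def)
  qed
  have QE: "even_connected \<phi> (Q Y \<mu> \<inter> E)" if Y: "closed_under \<phi> F Y" and \<mu>: "\<mu> \<in> {1, 2}" for Y \<mu>
  proof -
    \<comment> \<open>On \<open>E\<close> the interchange runs along \<open>?S\<close>, which is
      even: at a vertex in \<open>Y\<close> it contains all edges colored 1 or 2, elsewhere
      none.\<close>
    let ?S = "{e\<in>E. c e \<in> {1, 2} \<and> cut_ends \<phi> Y e \<noteq> 0}"
    have SF: "e \<in> F" if "e \<in> E" "c e \<in> {1, 2}" for e using that ED by (auto simp: F_def k_def)
    have "even (total_ends \<phi> ?S {v})" for v
    proof (cases "v \<in> Y")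
      case True
      have "total_ends \<phi> ?S {v} = total_ends \<phi> {e\<in>E. c e \<in> {1, 2}} {v}"
        using finE SF Fcut[OF Y] True by (intro total_ends_cong_at) auto
      then show ?thesis using even_colors_12[OF finE c0] by simp
    next
      case False
      have "total_ends \<phi> ?S {v} = total_ends \<phi> {} {v}"
        using finE SF Fcut[OF Y] False by (intro total_ends_cong_at) auto
      then show ?thesis by (simp add: total_ends_def)
    qed
    moreover have "?S \<subseteq> {e\<in>E. c e \<in> {1, 2}}" by auto
    ultimately have "even_connected \<phi> {e\<in>E. swap_colors c ?S e \<in> {0, \<mu>}}"
      using swappable_coloringD[OF c[folded E_def], of ?S] \<mu> by blast
    moreover have "sw Y e = swap_colors c ?S e" if "e \<in> E" for e
      using that ED by (auto simp: sw_def swap_colors_def F_def k_def)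
    then have "{e\<in>E. swap_colors c ?S e \<in> {0, \<mu>}} = Q Y \<mu> \<inter> E" using ED unfolding Q_def by auto
    ultimately show ?thesis by simp
  qed
  have Qeven: "even (total_ends \<phi> (Q Y \<mu>) {v})" if Y: "closed_under \<phi> F Y" and \<mu>: "\<mu> \<in> {1, 2}" for Y \<mu> v
  proof (cases "v \<in> W")
    case True
    have "total_ends \<phi> (Q Y \<mu>) {v} = total_ends \<phi> (Q Y \<mu> \<inter> E) {v}"
      using finQ True EW QD[of Y \<mu>] by (intro total_ends_cong_at) auto
    then show ?thesis using QE[OF that] by (simp add: even_connected_def)
  next
    case False
    \<comment> \<open>Outside \<open>W\<close> all edges at \<open>v\<close> have one color, so
      \<open>Q Y \<mu>\<close> contains all edges of \<open>D\<close> at \<open>v\<close> or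
      none.\<close>
    have col: "sw Y e = (if v \<in> Y then 2 else 1)" if "e \<in> D" "v \<in># \<phi> e" for e
      using sw[OF Y that] EW[OF that] False by (simp add: k_def)
    have "total_ends \<phi> (Q Y \<mu>) {v} = total_ends \<phi> (if v \<in> Y \<longleftrightarrow> \<mu> = 2 then D else {}) {v}"
      using fin finQ col \<mu> by (intro total_ends_cong_at) (auto simp: Q_def)
    moreover have "even (total_ends \<phi> D {v})"
    proof (cases "v \<in> V")
      case True
      then show ?thesis using circ False by simp
    next
      case v: False
      have "total_ends \<phi> D {v} = total_ends \<phi> {} {v}"
        using fin inV v by (intro total_ends_cong_at) auto
      then show ?thesis by (simp add: total_ends_def)
    qed
    ultimately show ?thesis by (simp add: total_ends_def)
  qed
  \<comment> \<open>With \<open>Y = {}\<close> the parities just shown apply to \<open>k\<close>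
    itself.\<close>
  have sw0: "sw {} = k" by (auto simp: sw_def swap_colors_def cut_ends_def fun_eq_iff)
  have closed0: "closed_under \<phi> F {}" by (simp add: closed_under_def cut_ends_def)
  have keven: "even (total_ends \<phi> {e\<in>D. k e \<in> {0, \<mu>}} {v})" if "\<mu> \<in> {1, 2}" for \<mu> v
    using Qeven[OF closed0 that, of v] unfolding Q_def sw0 .
  have Feven: "even (total_ends \<phi> F {v})" for v
    unfolding F_def using even_colors_12[OF fin(2) keven] by blast

  \<comment> \<open>An end of an edge of \<open>M\<close> has degree 1 or 2 in \<open>D\<close>, and
    its edges in \<open>D\<close> share a color, so any one of them may define
    \<open>col\<close>.\<close>
  define col where "col v = k (SOME g. g \<in> D \<and> v \<in># \<phi> g)" for v
  have deg_D: "0 < total_ends \<phi> D {v}" "total_ends \<phi> D {v} \<le> 2" if "e \<in> M" "v \<in># \<phi> e" for e v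
  proof -
    have v: "v \<in> V" using that inV by blast
    then show "0 < total_ends \<phi> D {v}" using posW circ[of v] by (cases "v \<in> W") auto
    have "count (\<phi> e) v \<le> total_ends \<phi> M {v}"
      unfolding total_ends_singleton using that(1) fin(3) by (intro member_le_sum) auto
    then have "0 < total_ends \<phi> M {v}" using that(2) by (metis count_greater_zero_iff less_le_trans)
    then show "total_ends \<phi> D {v} \<le> 2" using deg3[OF v] total_ends_union[OF fin(2,3) disj, of \<phi> "{v}"] by simp
  qed
  have incident: "\<exists>g\<in>D. v \<in># \<phi> g" if "e \<in> M" "v \<in># \<phi> e" for e v
  proof (rule ccontr)
    assume "\<not> ?thesis"
    then have "total_ends \<phi> D {v} = total_ends \<phi> {} {v}" using fin by (intro total_ends_cong_at) auto
    then show False using deg_D[OF that] by (simp add: total_ends_def)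
  qed
  have col: "k g = col v" if "e \<in> M" "v \<in># \<phi> e" "g \<in> D" "v \<in># \<phi> g" for e v g
  proof -
    have "(SOME g. g \<in> D \<and> v \<in># \<phi> g) \<in> D \<and> v \<in># \<phi> (SOME g. g \<in> D \<and> v \<in># \<phi> g)"
      using that(3,4) by (rule_tac someI) auto
    then show ?thesis unfolding col_def
      using monochromatic_vertex[OF fin(2) kD keven deg_D(2)[OF that(1,2)] that(3,4)] by blast
  qed
  have col_range: "col v \<in> {0, 1, 2}" if "e \<in> M" "v \<in># \<phi> e" for e v
    using incident[OF that] col[OF that] kD by (metis image_subset_iff)

  define N where "N = {e\<in>M. \<forall>v. v \<in># \<phi> e \<longrightarrow> col v \<noteq> 0}"
  have "finite N" "N \<inter> F = {}" using fin disj FD by (auto simp: N_def)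
  \<comment> \<open>An edge of \<open>N\<close> is odd on the vertices colored 1 exactly if its ends
    have different colors 1 and 2. Switching along \<open>Y\<close> equalizes the ends of every edge
    outside \<open>B\<close>.\<close>
  then obtain B Y where BN: "B \<subseteq> N" and Bev: "\<And>X. closed_under \<phi> F X \<Longrightarrow> even (total_ends \<phi> B X)"
    and Y: "closed_under \<phi> F Y"
    and bal: "\<And>e. e \<in> N - B \<Longrightarrow> odd (cut_ends \<phi> Y e) \<longleftrightarrow> odd (cut_ends \<phi> {v. col v = 1} e)"
    using balancing_switch[OF _ finF, of N \<phi> "\<lambda>e. odd (cut_ends \<phi> {v. col v = 1} e)"] by blast
  define col' where "col' v = (if col v = 0 then 0 else if v \<in> Y then 3 - col v else col v)" for v
  have col': "sw Y g = col' v" if "e \<in> M" "v \<in># \<phi> e" "g \<in> D" "v \<in># \<phi> g" for e v g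
    using sw[OF Y that(3,4)] col[OF that] by (simp add: col'_def)
  have col'_range: "col' v \<in> {0, 1, 2}" if "e \<in> M" "v \<in># \<phi> e" for e v
    using col_range[OF that] by (auto simp: col'_def)
  have col'_outW: "col' v = (if v \<in> Y then 2 else 1)" if ev: "e \<in> M" "v \<in># \<phi> e" "v \<notin> W" for e v
  proof -
    obtain g where g: "g \<in> D" "v \<in># \<phi> g" using incident[OF ev(1,2)] by blast
    then have "col v = 1" using col[OF ev(1,2) g] EW[OF g] ev(3) by (simp add: k_def)
    then show ?thesis by (simp add: col'_def)
  qed
  have same: "col' u = col' w" if "e \<in> N - B" "\<phi> e = {#u, w#}" for e u w
  proof -
    let ?A = "{v. col v = 1}"
    have e: "e \<in> M" using that(1) by (simp add: N_def)
    have "even (cut_ends \<phi> (sym_diff ?A Y) e)"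
      unfolding cut_ends_sym_diff using bal[OF that(1)] by blast
    then have "u \<in> sym_diff ?A Y \<longleftrightarrow> w \<in> sym_diff ?A Y"
      using that(2) by (auto simp: cut_ends_def split: if_splits)
    moreover have "col u \<noteq> 0" "col w \<noteq> 0" using that by (auto simp: N_def)
    moreover have "col u \<in> {0, 1, 2}" "col w \<in> {0, 1, 2}" using col_range[OF e] that(2) by auto
    ultimately show ?thesis by (auto simp: col'_def)
  qed
  \<comment> \<open>Edges of \<open>M - B\<close> with both ends colored 0 would fit either color;
    they go to \<open>MM 1\<close>, so that \<open>MM 1\<close> and \<open>MM 2\<close> partition
    \<open>M - B\<close>.\<close>
  define MM where "MM \<mu> = (if \<mu> = (1::nat) then {e\<in>M - B. \<forall>v. v \<in># \<phi> e \<longrightarrow> col' v \<in> {0, 1}}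
    else {e\<in>M - B. \<exists>v. v \<in># \<phi> e \<and> col' v \<notin> {0, 1}})" for \<mu>
  have MM_M: "MM \<mu> \<subseteq> M - B" for \<mu> by (auto simp: MM_def)
  have finMM: "finite (MM \<mu>)" for \<mu> using MM_M fin finite_subset by (metis finite_Diff)
  have finB: "finite B" and BM: "B \<subseteq> M" using BN \<open>finite N\<close> finite_subset by (auto simp: N_def)
  have MM_split: "M = MM 1 \<union> (MM 2 \<union> B)" "MM 1 \<inter> (MM 2 \<union> B) = {}" "MM 2 \<inter> B = {}"
    using BM by (auto simp: MM_def)
  have MM_col: "col' v \<in> {0, \<mu>}" if asm: "\<mu> \<in> {1, 2}" "e \<in> MM \<mu>" "v \<in># \<phi> e" for \<mu> e v
  proof (cases "\<mu> = 1")
    case True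
    then show ?thesis using asm by (simp add: MM_def)
  next
    case False
    then have \<mu>: "\<mu> = 2" using asm by simp
    have e: "e \<in> M" "e \<notin> B" using asm MM_M by auto
    obtain u where u: "u \<in># \<phi> e" "col' u \<notin> {0, 1}" using asm \<mu> by (auto simp: MM_def)
    then have u2: "col' u = 2" using col'_range[OF e(1) u(1)] by auto
    obtain a b where ab: "\<phi> e = {#a, b#}" using pair_of_size_2 size2 e by (metis UnI2)
    \<comment> \<open>One end \<open>u\<close> has color 2. If the edge is in \<open>N\<close>,
      balancing gives the other end color 2 as well; otherwise some end has color 0, and it must be
      the other one.\<close>
    show ?thesis
    proof (cases "e \<in> N")
      case True
      then have "col' a = col' b" using same ab e by blast
      then show ?thesis using ab u u2 asm(3) \<mu> by auto
    next
      case False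
      then obtain w where "w \<in># \<phi> e" "col' w = 0" using e by (auto simp: N_def col'_def)
      then show ?thesis using ab u u2 asm(3) \<mu> by auto
    qed
  qed
  \<comment> \<open>A set avoiding the Hamilton circuit of \<open>H\<^sub>0\<close> may be cut down to the circuits of \<open>H\<close> that carry
     color \<open>\<mu>\<close>; there all ends of \<open>M\<close> belong to \<open>MM \<mu>\<close> or \<open>B\<close>, and the frame property applies.\<close>
  have avoid: "even (total_ends \<phi> (MM \<mu>) X)"
    if \<mu>: "\<mu> \<in> {1, 2}" and X: "closed_under \<phi> (Q Y \<mu>) X" and CX: "covered \<phi> (Q Y \<mu> \<inter> E) \<inter> X = {}" for \<mu> X
  proof -
    define X' where "X' = {v\<in>X. v \<in> V \<and> v \<notin> W \<and> (v \<in> Y \<longleftrightarrow> \<mu> = 2)}"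
    have "cut_ends \<phi> X e = cut_ends \<phi> X' e" if e: "e \<in> MM \<mu>" for e
    proof (rule cut_ends_cong)
      fix v assume v: "v \<in># \<phi> e"
      have eM: "e \<in> M" using e MM_M by blast
      have "v \<in> X'" if "v \<in> X"
      proof -
        obtain g where g: "g \<in> D" "v \<in># \<phi> g" using incident[OF eM v] by blast
        have c: "col' v \<in> {0, \<mu>}" using MM_col[OF \<mu> e v] .
        then have "g \<in> Q Y \<mu>" using col'[OF eM v g] g by (simp add: Q_def)
        then have "g \<notin> E" using CX that g by (auto simp: covered_def)
        then have "v \<notin> W" using EW[OF g] by simp
        then show ?thesis using c col'_outW[OF eM v] that inV[of e] eM v \<mu> by (auto simp: X'_def split: if_splits)
      qed
      then show "v \<in> X \<longleftrightarrow> v \<in> X'" by (auto simp: X'_def)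
    qed
    then have "total_ends \<phi> (MM \<mu>) X = total_ends \<phi> (MM \<mu>) X'" by (simp add: total_ends_def)
    moreover have "closed_under \<phi> D X'"
      unfolding closed_under_def
    proof
      fix e assume e: "e \<in> D"
      obtain v where v: "v \<in># \<phi> e" using nonempty e by blast
      show "even (cut_ends \<phi> X' e)"
      \<comment> \<open>Edges in \<open>W\<close> or on a circuit of the other color miss
        \<open>X'\<close>. Every other edge has color \<open>\<mu>\<close>, so it lies in
        \<open>Q Y \<mu>\<close>, and there \<open>X'\<close> agrees with \<open>X\<close>.\<close>
      proof (cases "e \<in> E \<or> \<not> (v \<in> Y \<longleftrightarrow> \<mu> = 2)")
        case True
        have "set_mset (\<phi> e) \<inter> X' = {}"
        proof (cases "e \<in> E")
          case True
          then show ?thesis by (auto simp: E_def X'_def)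
        next
          case False
          then have "e \<in> F" using e by (simp add: F_def k_def)
          then have "u \<in> Y \<longleftrightarrow> v \<in> Y" if "u \<in># \<phi> e" for u using Fcut[OF Y] v that by blast
          then show ?thesis using True False by (auto simp: X'_def)
        qed
        then show ?thesis by (simp add: cut_ends_eq_0_iff[THEN iffD2])
      next
        case False
        then have "e \<in> F" using e by (simp add: F_def k_def)
        then have Yv: "u \<in> Y \<longleftrightarrow> v \<in> Y" if "u \<in># \<phi> e" for u using Fcut[OF Y] v that by blast
        have "sw Y e = \<mu>" using sw[OF Y e v] False \<mu> by (auto simp: k_def)
        then have "even (cut_ends \<phi> X e)" using X e by (simp add: closed_under_def Q_def)
        moreover have "cut_ends \<phi> X e = cut_ends \<phi> X' e"
        proof (rule cut_ends_cong)
          fix u assume u: "u \<in># \<phi> e"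
          have "u \<notin> W" "u \<in> V" using False e u outW[of e] inV[of e] by auto
          then show "u \<in> X \<longleftrightarrow> u \<in> X'" using Yv[OF u] False by (simp add: X'_def)
        qed
        ultimately show ?thesis by simp
      qed
    qed
    moreover have "X' \<subseteq> V" by (auto simp: X'_def)
    ultimately have "even (total_ends \<phi> M X')" "even (total_ends \<phi> B X')"
      using frame[of X'] Bev[of X'] FD by (auto simp: closed_under_def)
    \<comment> \<open>The other color is \<open>3 - \<mu>\<close>. An end in \<open>X'\<close> has
      color \<open>\<mu>\<close>, which \<open>MM (3 - \<mu>)\<close> excludes; so only
      \<open>MM \<mu>\<close> and \<open>B\<close> contribute to the even count of \<open>M\<close>
      on \<open>X'\<close>.\<close>
    moreover have "total_ends \<phi> (MM (3 - \<mu>)) X' = 0"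
    proof -
      have "set_mset (\<phi> e) \<inter> X' = {}" if e: "e \<in> MM (3 - \<mu>)" for e
      proof (rule ccontr)
        assume "\<not> ?thesis"
        then obtain v where v: "v \<in># \<phi> e" "v \<in> X'" by blast
        have "e \<in> M" using e MM_M by blast
        then have "col' v = \<mu>" using col'_outW v \<mu> by (auto simp: X'_def)
        moreover have "col' v \<in> {0, 3 - \<mu>}" using MM_col[OF _ e v(1)] \<mu> by auto
        ultimately show False using \<mu> by auto
      qed
      then show ?thesis unfolding total_ends_def by (intro sum.neutral) (simp add: cut_ends_eq_0_iff)
    qed
    moreover have "total_ends \<phi> M X' = total_ends \<phi> (MM 1) X' + (total_ends \<phi> (MM 2) X' + total_ends \<phi> B X')"
      using MM_split finMM finB by (metis total_ends_union finite_UnI)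
    ultimately have "even (total_ends \<phi> (MM \<mu>) X')" using \<mu> by auto
    then show ?thesis using \<open>total_ends \<phi> (MM \<mu>) X = total_ends \<phi> (MM \<mu>) X'\<close> by simp
  qed
  have Qjoin: "even (total_ends \<phi> (MM \<mu>) X)" if \<mu>: "\<mu> \<in> {1, 2}" and X: "closed_under \<phi> (Q Y \<mu>) X" for \<mu> X
  proof -
    have "closed_under \<phi> (Q Y \<mu> \<inter> E) X" using X by (auto simp: closed_under_def)
    then consider "covered \<phi> (Q Y \<mu> \<inter> E) \<inter> X = {}" | "covered \<phi> (Q Y \<mu> \<inter> E) \<subseteq> X"
      using QE[OF Y \<mu>] unfolding even_connected_def by blast
    then show ?thesis
    proof cases
      case 1
      then show ?thesis using avoid[OF \<mu> X] by blast
    next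
      case 2
      \<comment> \<open>Now \<open>- X\<close> avoids the connected part inside \<open>W\<close>. As
        every edge has two ends, counts on \<open>X\<close> and \<open>- X\<close> have equal
        parity.\<close>
      have compl: "even (cut_ends \<phi> (- X) e) \<longleftrightarrow> even (cut_ends \<phi> X e)" if "e \<in> D \<union> M" for e
        using cut_ends_Compl[of \<phi> X e] size2[OF that] by (metis even_add even_numeral)
      have "closed_under \<phi> (Q Y \<mu>) (- X)" using X compl QD[of Y \<mu>] by (auto simp: closed_under_def)
      then have "even (total_ends \<phi> (MM \<mu>) (- X))" using avoid[OF \<mu>] 2 by blast
      moreover have "total_ends \<phi> (MM \<mu>) X + total_ends \<phi> (MM \<mu>) (- X) = (\<Sum>e\<in>MM \<mu>. 2)"
        unfolding total_ends_def sum.distrib[symmetric] cut_ends_Compl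
        using size2 MM_M by (intro sum.cong) auto
      ultimately show ?thesis by (metis even_add even_numeral dvd_sum)
    qed
  qed
  have "\<exists>P\<subseteq>Q Y \<mu>. \<forall>v. even (total_ends \<phi> (MM \<mu> \<union> P) {v}) \<and> even (total_ends \<phi> (MM \<mu> \<union> (Q Y \<mu> - P)) {v})"
    if "\<mu> \<in> {1, 2}" for \<mu>
    using finQ finMM Qeven[OF Y that] Qjoin[OF that] QD MM_M disj
    by (intro complementary_joins) blast+
  then obtain P where P: "\<And>\<mu>. \<mu> \<in> {1, 2} \<Longrightarrow> P \<mu> \<subseteq> Q Y \<mu>"
    "\<And>\<mu> v. \<mu> \<in> {1, 2} \<Longrightarrow> even (total_ends \<phi> (MM \<mu> \<union> P \<mu>) {v})"
    "\<And>\<mu> v. \<mu> \<in> {1, 2} \<Longrightarrow> even (total_ends \<phi> (MM \<mu> \<union> (Q Y \<mu> - P \<mu>)) {v})"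
    by metis
  have "F \<inter> B = {}" using FD BM disj by blast
  from complementary_joins[OF finF finB this Feven Bev]
  obtain R where R: "R \<subseteq> F" "\<And>v. even (total_ends \<phi> (B \<union> R) {v})"
      "\<And>v. even (total_ends \<phi> (B \<union> (F - R)) {v})" by blast
  \<comment> \<open>An edge of \<open>D\<close> lies in exactly two of \<open>Q Y 1\<close>,
    \<open>Q Y 2\<close> and \<open>F\<close>, and in one of the two members built on each. An edge
    of \<open>M\<close> lies in exactly one of \<open>MM 1\<close>, \<open>MM 2\<close> and
    \<open>B\<close>, hence in both members built on it.\<close>
  define L where "L = [MM 1 \<union> P 1, MM 1 \<union> (Q Y 1 - P 1), MM 2 \<union> P 2, MM 2 \<union> (Q Y 2 - P 2), B \<union> R, B \<union> (F - R)]"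
  have sub: "P 1 \<subseteq> Q Y 1" "P 2 \<subseteq> Q Y 2" "Q Y 1 \<subseteq> D" "Q Y 2 \<subseteq> D" "MM 1 \<subseteq> M - B" "MM 2 \<subseteq> M - B"
    using P(1) QD MM_M by auto
  have "A \<subseteq> D \<union> M" if "A \<in> set L" for A
    using that sub R(1) FD BM unfolding L_def by auto
  moreover have "even (total_ends \<phi> A {v})" if "A \<in> set L" for A v
    using that P(2,3)[of 1 v] P(2,3)[of 2 v] R(2,3)[of v] unfolding L_def by auto
  ultimately have *: "\<forall>A\<in>set L. A \<subseteq> D \<union> M \<and> (\<forall>v. even (total_ends \<phi> A {v}))" by simp
  have "\<forall>i<6. L ! i \<subseteq> D \<union> M \<and> (\<forall>v. even (total_ends \<phi> (L ! i) {v}))"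
  proof -
    have "length L = 6" by (simp add: L_def)
    then show ?thesis using * nth_mem[of _ L] by metis
  qed
  moreover have "card {i. i < 6 \<and> e \<in> L ! i} = 2" if e: "e \<in> D \<union> M" for e
  proof -
    have "card {i. i < 6 \<and> e \<in> L ! i} = (\<Sum>i<6. of_bool (e \<in> L ! i))"
      by (simp add: sum.If_cases of_bool_def Int_def lessThan_def)
    also have "\<dots> = of_bool (e \<in> L ! 0) + of_bool (e \<in> L ! 1) + of_bool (e \<in> L ! 2) +
        of_bool (e \<in> L ! 3) + of_bool (e \<in> L ! 4) + of_bool (e \<in> L ! 5)"
      by (simp add: eval_nat_numeral)
    also have "\<dots> = 2"
    proof (cases "e \<in> D")
      case True
      then have "e \<notin> M" using disj by blast
      then have no: "e \<notin> MM 1" "e \<notin> MM 2" "e \<notin> B" using sub BM by auto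
      have imp: "e \<in> P 1 \<Longrightarrow> e \<in> Q Y 1" "e \<in> P 2 \<Longrightarrow> e \<in> Q Y 2" "e \<in> R \<Longrightarrow> e \<in> F"
        using sub R(1) by auto
      have "k e \<in> {0, 1, 2}" using kD True by blast
      obtain v where v: "v \<in># \<phi> e" using nonempty e by blast
      have "sw Y e \<in> {0, 1, 2}" "e \<in> F \<longleftrightarrow> sw Y e \<noteq> 0"
        using sw[OF Y True v] \<open>k e \<in> {0, 1, 2}\<close> True by (auto simp: F_def)
      moreover have "e \<in> Q Y 1 \<longleftrightarrow> sw Y e \<in> {0, 1}" "e \<in> Q Y 2 \<longleftrightarrow> sw Y e \<in> {0, 2}"
        using True by (auto simp: Q_def)
      ultimately show ?thesis using no imp by (auto simp: L_def)
    next
      case False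
      then have "e \<in> M" "e \<notin> P 1" "e \<notin> P 2" "e \<notin> R" "e \<notin> Q Y 1" "e \<notin> Q Y 2" "e \<notin> F"
        using e sub R(1) FD by auto
      then show ?thesis using MM_split by (auto simp: L_def)
    qed
    finally show ?thesis .
  qed
  ultimately show ?thesis by blast
qed

section \<open>Components of the frame, contraction, and assembly\<close>

lemma reachable_from_refl: "v \<in> reachable_from G v"
  by (simp add: reachable_from_def)

lemma closed_under_reachable_from:
  assumes "\<And>e. e \<in> edges G \<Longrightarrow> size (ends G e) = 2"
  shows "closed_under (ends G) (edges G) (reachable_from G v)"
  unfolding closed_under_def
proof
  fix e assume e: "e \<in> edges G"
  obtain u w where uw: "ends G e = {#u, w#}" using pair_of_size_2 assms[OF e] by metis
  moreover have "{#u, w#} = {#w, u#}" by simp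
  ultimately have "adjacent G u w" "adjacent G w u" using e unfolding adjacent_def by metis+
  then have "u \<in> reachable_from G v \<longleftrightarrow> w \<in> reachable_from G v"
    unfolding reachable_from_def by (auto intro: rtranclp.rtrancl_into_rtrancl)
  then show "even (cut_ends (ends G) (reachable_from G v) e)" using uw by (simp add: cut_ends_def)
qed

lemma size_filter_mset_fibres:
  assumes "finite K"
  shows "size {#u \<in># m. f u \<in> K#} = (\<Sum>k\<in>K. count (image_mset f m) k)"
proof (induction m)
  case (add x m)
  have "(\<Sum>k\<in>K. count (image_mset f (add_mset x m)) k) =
      (\<Sum>k\<in>K. (if k = f x then 1 else 0) + count (image_mset f m) k)"
    by (intro sum.cong) auto
  then show ?case using assms add by (simp add: sum.distrib)
qed simp

text \<open>A closed \<open>X\<close> is a union of vertex sets of components of \<open>H\<close>,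
  that is, of vertices of the contraction. Double counting turns its ends into a sum of degrees in
  \<open>contract G H\<close>, all even.\<close>

lemma frame_even_total_ends:
  assumes G: "finite_graph G" and "frame G H"
    and X: "X \<subseteq> verts G" "closed_under (ends G) (edges H) X"
  shows "even (total_ends (ends G) (edges G - edges H) X)"
proof -
  let ?R = "reachable_from H" and ?M = "edges G - edges H"
  have H: "ends H = ends G" "edges H \<subseteq> edges G" "even_graph (contract G H)"
    using assms(2) by (auto simp: frame_def subgraph_def)
  have size2: "size (ends H e) = 2" if "e \<in> edges H" for e
    using that G H by (auto simp: finite_graph_def)
  have finX: "finite X" using X(1) G finite_subset by (auto simp: finite_graph_def)
  have "?R u \<in> ?R ` X \<longleftrightarrow> u \<in> X" for u
  proof
    assume "?R u \<in> ?R ` X"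
    then obtain w where "w \<in> X" "u \<in> ?R w" using reachable_from_refl by (metis imageE)
    then show "u \<in> X" using reachable_from_closed[of H X w u] X(2) size2 H(1) by simp
  qed blast
  then have "cut_ends (ends G) X e = (\<Sum>k\<in>?R ` X. count (image_mset ?R (ends G e)) k)" for e
    using size_filter_mset_fibres[of "?R ` X" ?R "ends G e"] finX by (simp add: cut_ends_def)
  then have "total_ends (ends G) ?M X = (\<Sum>e\<in>?M. \<Sum>k\<in>?R ` X. count (image_mset ?R (ends G e)) k)"
    by (simp add: total_ends_def)
  also have "\<dots> = (\<Sum>k\<in>?R ` X. deg (contract G H) k)"
    unfolding deg_def contract_def by (simp, rule sum.swap)
  also have "even \<dots>"
    using H(3) X(1) by (intro dvd_sum) (auto simp: even_graph_def contract_def)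
  finally show ?thesis .
qed

theorem theorem1p17:
  fixes G H :: "('v, 'e) multigraph"
  assumes "finite_graph G" and "cubic G" and "bridgeless G"
    and "semi_kotzig_frame G H"
    and "card {C \<in> graph_components H. \<not> circuit C} \<le> 1"
  shows "\<exists>C. even_subgraph_double_cover 6 G C"
proof -
  let ?\<phi> = "ends G" and ?R = "reachable_from H"
  define D where "D = edges H"
  define M where "M = edges G - edges H"
  have frame: "frame G H" using assms(4) by (simp add: semi_kotzig_frame_def)
  have H: "ends H = ?\<phi>" "D \<subseteq> edges G" "verts H = verts G"
    using frame by (auto simp: frame_def subgraph_def D_def)
  have fin: "finite (verts G)" "finite D" "finite M"
    using assms(1) H(2) finite_subset by (auto simp: finite_graph_def M_def)
  have DM: "D \<union> M = edges G" "D \<inter> M = {}" using H(2) by (auto simp: D_def M_def)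
  have ends: "size (?\<phi> e) = 2" "set_mset (?\<phi> e) \<subseteq> verts G" if "e \<in> D \<union> M" for e
    using that assms(1) DM by (auto simp: finite_graph_def)
  have size2: "size (ends H e) = 2" if "e \<in> edges H" for e
    using that ends(1) H(1) by (simp add: D_def)
  have closedR: "closed_under ?\<phi> D (?R v)" for v
    using closed_under_reachable_from[OF size2] H(1) by (simp add: D_def)
  define comp where "comp v = vertex_induced H (?R v)" for v
  have comp: "verts (comp v) = ?R v" "edges (comp v) = {e\<in>D. set_mset (?\<phi> e) \<subseteq> ?R v}" "ends (comp v) = ?\<phi>" for v
    by (simp_all add: comp_def vertex_induced_def D_def H(1))
  have comps: "graph_components H = comp ` verts G" by (simp add: graph_components_def comp_def H(3))
  have deg_comp: "deg (comp u) v = total_ends ?\<phi> D {v}" if "v \<in> ?R u" for u v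
  proof -
    have "total_ends ?\<phi> {e\<in>D. set_mset (?\<phi> e) \<subseteq> ?R u} {v} = total_ends ?\<phi> D {v}"
    proof (rule total_ends_cong_at)
      fix e assume "v \<in># ?\<phi> e"
      then show "e \<in> {e\<in>D. set_mset (?\<phi> e) \<subseteq> ?R u} \<longleftrightarrow> e \<in> D"
        using closedR[of u] that even_cut_ends_iff[of ?\<phi> e "?R u"] ends(1)[of e] by (auto simp: closed_under_def)
    qed (use fin in auto)
    then show ?thesis by (simp add: deg_def comp total_ends_singleton)
  qed
  have circ: "total_ends ?\<phi> D {v} = 2" if "circuit (comp v)" for v
    using that deg_comp[OF reachable_from_refl, of v]
    by (simp add: circuit_def regular_def comp reachable_from_refl)
  \<comment> \<open>If every component is a circuit, \<open>W\<close> is empty and the coloring of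
    the empty edge set is arbitrary.\<close>
  obtain W c where W: "closed_under ?\<phi> D W" "swappable_coloring ?\<phi> {e\<in>D. set_mset (?\<phi> e) \<subseteq> W} c"
    "\<And>v. v \<in> verts G \<inter> W \<Longrightarrow> total_ends ?\<phi> D {v} > 0" "\<And>v. v \<in> verts G - W \<Longrightarrow> circuit (comp v)"
  proof (cases "\<exists>w\<in>verts G. \<not> circuit (comp w)")
    case True
    then obtain w where w: "w \<in> verts G" "\<not> circuit (comp w)" by blast
    obtain K where "suppressed_graph (comp w) K" "semi_kotzig_graph K"
      using assms(4) w comps unfolding semi_kotzig_frame_def by blast
    from suppressed_semi_kotzig_swappable[OF this]
    obtain c where "swappable_coloring ?\<phi> {e\<in>D. set_mset (?\<phi> e) \<subseteq> ?R w} c"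
      and "\<And>v. v \<in> ?R w \<Longrightarrow> deg (comp w) v > 0" by (auto simp: comp)
    \<comment> \<open>Two distinct non-circuit components would give the finite set of such
      components cardinality at least 2. So \<open>comp v\<close> would equal \<open>comp w\<close>,
      putting \<open>v\<close> into \<open>?R w\<close>.\<close>
    moreover have "circuit (comp v)" if v: "v \<in> verts G - ?R w" for v
    proof (rule ccontr)
      assume "\<not> circuit (comp v)"
      then have sub: "{comp v, comp w} \<subseteq> {C \<in> graph_components H. \<not> circuit C}"
        using v w comps by auto
      have "finite {C \<in> graph_components H. \<not> circuit C}" using comps fin by simp
      then have "card {comp v, comp w} \<le> 1" using card_mono[OF _ sub] assms(5) by linarith
      then have "comp v = comp w" by (auto simp: card_insert_if split: if_splits)
      then have "?R v = ?R w" using comp(1) by metis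
      then show False using v reachable_from_refl[of v H] by simp
    qed
    ultimately show thesis using that[of "?R w" c] closedR deg_comp[of _ w] by simp
  next
    case False
    have "swappable_coloring ?\<phi> {} (\<lambda>_. 0)"
      by (simp add: swappable_coloring_def even_connected_def covered_def total_ends_def)
    moreover have "{e\<in>D. set_mset (?\<phi> e) \<subseteq> {}} = {}" using ends(1) by fastforce
    ultimately have "swappable_coloring ?\<phi> {e\<in>D. set_mset (?\<phi> e) \<subseteq> {}} (\<lambda>_. 0)" by metis
    then show thesis using that[of "{}"] False by (auto simp: closed_under_def cut_ends_def)
  qed
  have "\<exists>A. (\<forall>i<6::nat. A i \<subseteq> D \<union> M \<and> (\<forall>v. even (total_ends ?\<phi> (A i) {v}))) \<and>
      (\<forall>e\<in>D \<union> M. card {i. i < 6 \<and> e \<in> A i} = 2)"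
  proof (rule six_cover_of_swappable_coloring[OF fin DM(2) ends _ W(1-3)])
    show "total_ends ?\<phi> (D \<union> M) {v} = 3" if "v \<in> verts G" for v
      using assms(2) that by (simp add: DM regular_def deg_def total_ends_singleton)
    show "total_ends ?\<phi> D {v} = 2" if "v \<in> verts G - W" for v
      using circ W(4) that by blast
    show "even (total_ends ?\<phi> M X)" if "X \<subseteq> verts G" "closed_under ?\<phi> D X" for X
      using frame_even_total_ends[OF assms(1) frame] that by (simp add: D_def M_def)
  qed
  then obtain A where "\<forall>i<6::nat. A i \<subseteq> edges G \<and> (\<forall>v. even (total_ends ?\<phi> (A i) {v}))"
    and A3: "\<forall>e\<in>edges G. card {i. i < 6 \<and> e \<in> A i} = 2"
    unfolding DM by (elim exE conjE)
  then have A: "A i \<subseteq> edges G" "even (total_ends ?\<phi> (A i) {v})" if "i < 6" for i v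
    using that by simp_all
  \<comment> \<open>Every member takes all vertices of \<open>G\<close>; those off
    \<open>A i\<close> have degree 0.\<close>
  define C where "C i = \<lparr>verts = verts G, edges = A i, ends = ?\<phi>\<rparr>" for i
  have "subgraph (C i) G \<and> even_graph (C i)" if "i < 6" for i
    using A(1)[OF that] A(2)[OF that] assms(1) finite_subset[OF A(1)[OF that]]
    by (auto simp: subgraph_def finite_graph_def even_graph_def deg_def C_def total_ends_singleton)
  moreover have "card {i. i < 6 \<and> e \<in> edges (C i)} = 2" if "e \<in> edges G" for e
    using A3 that by (simp add: C_def)
  ultimately have "even_subgraph_double_cover 6 G C" by (simp add: even_subgraph_double_cover_def)
  then show ?thesis by blast
qed

end
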